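(* Let $\boldsymbol{A}\in\mathbb{R}^{n\times d}$ be nonzero with $n>d$, let $\boldsymbol{b}\in\mathbb{R}^n$, let $\boldsymbol{x}_\star=\boldsymbol{A}^+\boldsymbol{b}$, and let $\kappa_{\rm dem}=\|\boldsymbol{A}^+\|\,\|\boldsymbol{A}\|_{\rm F}$. Let $\boldsymbol{x}_0\in\operatorname{range}(\boldsymbol{A}^\top)$, let $0\le t_{\rm b}<t$ be integers, let $\boldsymbol{x}_0,\boldsymbol{x}_1,\boldsymbol{x}_2,\ldots$ be the randomized Kaczmarz iterates for $(\boldsymbol{A},\boldsymbol{b})$ started at $\boldsymbol{x}_0$, and let $$\overline{\boldsymbol{x}}_t=\frac{1}{t-t_{\rm b}}\sum_{s=t_{\rm b}}^{t-1}\boldsymbol{x}_s$$ be the tail-averaged randomized Kaczmarz (TARK) estimator. Then $$\mathbb{E}\,\|\overline{\boldsymbol{x}}_t-\boldsymbol{x}_\star\|^2\le \bigl(1-\kappa_{\rm dem}^{-2}\bigr)^{t_{\rm b}}\,\|\boldsymbol{x}_0-\boldsymbol{x}_\star\|^2+\frac{2\kappa_{\rm dem}^2-1}{t-t_{\rm b}}\,\|\boldsymbol{A}^+\|^2\,\|\boldsymbol{b}-\boldsymbol{A}\boldsymbol{x}_\star\|^2 .$$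
   Context: $\|\cdot\|$ is the $\ell_2$ norm of a vector or the spectral norm of a matrix, $\|\cdot\|_{\rm F}$ is the Frobenius norm, and $\boldsymbol{A}^+$ is the Moore–Penrose pseudoinverse. $\boldsymbol{a}_i^\top$ is the $i$th row of $\boldsymbol{A}$ and $b_i$ the $i$th entry of $\boldsymbol{b}$. The randomized Kaczmarz (RK) iteration, started at a fixed (deterministic) $\boldsymbol{x}_0$, is: for $t=0,1,2,\ldots$, independently sample an index $i_t\in\{1,\ldots,n\}$ with $\mathbb{P}\{i_t=i\}=\|\boldsymbol{a}_i\|^2/\|\boldsymbol{A}\|_{\rm F}^2$ (so zero rows are never selected, almost surely) and set $$\boldsymbol{x}_{t+1}=\boldsymbol{x}_t+\frac{b_{i_t}-\boldsymbol{a}_{i_t}^\top\boldsymbol{x}_t}{\|\boldsymbol{a}_{i_t}\|^2}\,\boldsymbol{a}_{i_t}.$$ The expectation is over the random indices. The convention $0^0=1$ is used. *)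

theory Defs
  imports "HOL-Probability.Probability"
begin

definition spectral_norm :: "real^'d^'n \<Rightarrow> real" where
  "spectral_norm A = onorm (\<lambda>x. A *v x)"

definition frobenius_norm :: "real^'d^'n \<Rightarrow> real" where
  "frobenius_norm A = sqrt (\<Sum>i\<in>UNIV. \<Sum>j\<in>UNIV. (A $ i $ j)\<^sup>2)"

lemma frobenius_norm_eq_norm: "frobenius_norm A = norm A"
  by (simp add: frobenius_norm_def norm_vec_def L2_set_def sum_nonneg)

definition is_pseudoinverse :: "real^'d^'n \<Rightarrow> real^'n^'d \<Rightarrow> bool" where
  "is_pseudoinverse A P \<longleftrightarrow>
     A ** P ** A = A \<and> P ** A ** P = P \<and>
     transpose (A ** P) = A ** P \<and> transpose (P ** A) = P ** A"

definition pseudoinverse :: "real^'d^'n \<Rightarrow> real^'n^'d" where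
  "pseudoinverse A = (THE P. is_pseudoinverse A P)"

lemma is_pseudoinverse_unique:
  assumes "is_pseudoinverse A P" "is_pseudoinverse A Q"
  shows "P = Q"
proof -
  have P: "A ** P ** A = A" "P ** A ** P = P"
      "transpose (A ** P) = A ** P" "transpose (P ** A) = P ** A"
    and Q: "A ** Q ** A = A" "Q ** A ** Q = Q"
      "transpose (A ** Q) = A ** Q" "transpose (Q ** A) = Q ** A"
    using assms by (auto simp: is_pseudoinverse_def)
  have "A ** P = A ** Q ** (A ** P)"
    by (metis Q(1) matrix_mul_assoc)
  also have "\<dots> = transpose (A ** P ** (A ** Q))"
    by (metis P(3) Q(3) matrix_transpose_mul)
  also have "\<dots> = A ** Q"
    by (metis P(1) Q(3) matrix_mul_assoc)
  finally have AP: "A ** P = A ** Q" .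
  have "P ** A = P ** A ** (Q ** A)"
    by (metis Q(1) matrix_mul_assoc)
  also have "\<dots> = transpose (Q ** A ** (P ** A))"
    by (metis P(4) Q(4) matrix_transpose_mul)
  also have "\<dots> = Q ** A"
    by (metis P(1) Q(4) matrix_mul_assoc)
  finally have PA: "P ** A = Q ** A" .
  show ?thesis
    by (metis AP PA P(2) Q(2) matrix_mul_assoc)
qed

lemma orthogonal_projection_exists:
  fixes S :: "'a::euclidean_space set"
  assumes "subspace S"
  obtains h where "linear h" "\<And>x. h x \<in> S" "\<And>x. x \<in> S \<Longrightarrow> h x = x"
    "\<And>x y. h x \<bullet> y = x \<bullet> h y"
proof -
  obtain B where B: "B \<subseteq> S" "pairwise orthogonal B" "\<And>x. x \<in> B \<Longrightarrow> norm x = 1"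
    "independent B" "span B = S"
    using orthonormal_basis_subspace[OF assms] by metis
  have fin: "finite B" using B(4) independent_imp_finite by blast
  define h where "h x = (\<Sum>b\<in>B. (x \<bullet> b) *\<^sub>R b)" for x
  have lin: "linear h"
    unfolding h_def
    by (intro linear_compose_sum ballI linear_scaleR_left linearI) (auto simp: algebra_simps inner_add_left)
  have inS: "h x \<in> S" for x
    unfolding h_def using B(1) assms by (meson subsetD subspace_scale subspace_sum)
  have base: "h c = c" if "c \<in> B" for c
  proof -
    have "h c = (\<Sum>b\<in>B. if b = c then c else 0)"
      unfolding h_def using B(2,3) that
      by (intro sum.cong) (auto simp: pairwise_def orthogonal_def norm_eq_1)
    then show ?thesis using fin that by simp
  qed
  have idn: "h x = x" if "x \<in> S" for x
    using linear_eq_on[OF lin linear_ident, of x B] base that B(5) by auto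
  have sym: "h x \<bullet> y = x \<bullet> h y" for x y
    by (simp add: h_def inner_sum_left inner_sum_right inner_commute mult.commute)
  show thesis using that lin inS idn sym by blast
qed

lemma is_pseudoinverse_exists: "\<exists>P. is_pseudoinverse (A :: real^'d^'n) P"
proof -
  define S where "S = range (\<lambda>y. transpose A *v y)"
  define T where "T = range (\<lambda>x. A *v x)"
  have subS: "subspace S" and subT: "subspace T"
    unfolding S_def T_def
    by (rule linear_subspace_image[OF matrix_vector_mul_linear subspace_UNIV])+
  obtain p where p: "linear p" "\<And>x. p x \<in> S" "\<And>x. x \<in> S \<Longrightarrow> p x = x"
    "\<And>x y. p x \<bullet> y = x \<bullet> p y"
    using orthogonal_projection_exists[OF subS] by metis
  obtain q where q: "linear q" "\<And>x. q x \<in> T" "\<And>x. x \<in> T \<Longrightarrow> q x = x"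
    "\<And>x y. q x \<bullet> y = x \<bullet> q y"
    using orthogonal_projection_exists[OF subT] by metis
  have Ap: "A *v p x = A *v x" for x
  proof -
    have "(A *v x - A *v p x) \<bullet> z = 0" for z
    proof -
      have s: "transpose A *v z \<in> S" by (simp add: S_def)
      have "(A *v x - A *v p x) \<bullet> z = (x - p x) \<bullet> (transpose A *v z)"
        by (simp add: inner_diff_left dot_lmul_matrix inner_commute
            matrix_vector_mult_diff_distrib[symmetric])
      also have "\<dots> = 0"
        using p(4)[of x "transpose A *v z"] p(3)[OF s] by (simp add: inner_diff_left)
      finally show ?thesis .
    qed
    from this[of "A *v x - A *v p x"] show ?thesis by simp
  qed
  have inj: "inj_on (\<lambda>x. A *v x) S"
  proof (rule inj_onI)
    fix x y assume xy: "x \<in> S" "y \<in> S" "A *v x = A *v y"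
    then have "x - y \<in> S" using subS subspace_diff by blast
    then obtain z where z: "x - y = transpose A *v z" by (auto simp: S_def)
    have "(x - y) \<bullet> (x - y) = (A *v (x - y)) \<bullet> z"
      by (subst (2) z) (simp add: dot_lmul_matrix inner_commute)
    then show "x = y" using xy(3) by (simp add: matrix_vector_mult_diff_distrib)
  qed
  obtain g where g: "range g \<subseteq> S" "linear g" "\<And>v. v \<in> S \<Longrightarrow> g (A *v v) = v"
    using linear_exists_left_inverse_on[OF matrix_vector_mul_linear subS inj] by metis
  have gA: "g (A *v x) = p x" for x
    using g(3)[OF p(2)[of x]] Ap by simp
  have Ag: "A *v g y = y" if "y \<in> T" for y
    using that gA Ap by (auto simp: T_def)
  define P where "P = matrix (g \<circ> q)"
  have P: "P *v y = g (q y)" for y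
    unfolding P_def using fun_cong[OF matrix_vector_mul(2)[OF linear_compose[OF q(1) g(2)]]] by simp
  have AP: "A ** P *v y = q y" for y
    using Ag q(2) by (simp add: P matrix_vector_mul_assoc[symmetric])
  have PA: "P ** A *v x = p x" for x
    using gA q(3) by (simp add: P matrix_vector_mul_assoc[symmetric] T_def)
  have "A ** P ** A = A"
    by (simp add: matrix_eq matrix_vector_mul_assoc[symmetric, of "A ** P" A] AP q(3) T_def)
  moreover have "P ** A ** P = P"
  proof -
    have "p (g w) = g w" for w using p(3) g(1) by blast
    then show ?thesis
      by (simp add: matrix_eq matrix_vector_mul_assoc[symmetric, of "P ** A" P] PA P)
  qed
  moreover have sym: "transpose M = M"
    if "\<And>x y. (M *v x) \<bullet> y = x \<bullet> (M *v y)" for M :: "real^'k^'k"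
  proof -
    have "(transpose M *v x) \<bullet> y = (M *v x) \<bullet> y" for x y
      by (simp add: dot_lmul_matrix that)
    then have "transpose M *v x = M *v x" for x
      using vector_eq_rdot by blast
    then show ?thesis
      using matrix_eq by blast
  qed
  ultimately show ?thesis
    unfolding is_pseudoinverse_def using AP PA p(4) q(4) by (intro exI[of _ P] conjI sym) auto
qed

lemma is_pseudoinverse_pseudoinverse: "is_pseudoinverse A (pseudoinverse A)"
  unfolding pseudoinverse_def
  by (rule theI') (use is_pseudoinverse_exists is_pseudoinverse_unique in blast)

definition demmel_cond :: "real^'d^'n \<Rightarrow> real" where
  "demmel_cond A = spectral_norm (pseudoinverse A) * frobenius_norm A"

text \<open>The iterates along a fixed sequence \<open>idx\<close> of selected row indices. A zero row, which has
  selection probability zero, leaves the iterate unchanged because division by zero yields zero.\<close>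

primrec rk_iterate ::
  "real^'d^'n \<Rightarrow> real^'n \<Rightarrow> real^'d \<Rightarrow> (nat \<Rightarrow> 'n) \<Rightarrow> nat \<Rightarrow> real^'d" where
  "rk_iterate A b x\<^sub>0 idx 0 = x\<^sub>0"
| "rk_iterate A b x\<^sub>0 idx (Suc t) =
     (let i = idx t; x = rk_iterate A b x\<^sub>0 idx t
      in x + ((b $ i - row i A \<bullet> x) / (norm (row i A))\<^sup>2) *\<^sub>R row i A)"

definition tark ::
  "real^'d^'n \<Rightarrow> real^'n \<Rightarrow> real^'d \<Rightarrow> (nat \<Rightarrow> 'n) \<Rightarrow> nat \<Rightarrow> nat \<Rightarrow> real^'d" where
  "tark A b x\<^sub>0 idx t\<^sub>b t =
     (1 / (real t - real t\<^sub>b)) *\<^sub>R (\<Sum>s = t\<^sub>b..<t. rk_iterate A b x\<^sub>0 idx s)"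

text \<open>The indices selected by the algorithm: independent draws on a probability space \<open>M\<close>, each
  with probabilities proportional to the squared row norms.\<close>

definition rk_sampling :: "real^'d^'n \<Rightarrow> 'w measure \<Rightarrow> (nat \<Rightarrow> 'w \<Rightarrow> 'n) \<Rightarrow> bool" where
  "rk_sampling A M I \<longleftrightarrow>
     prob_space M \<and>
     prob_space.indep_vars M (\<lambda>_. count_space UNIV) I UNIV \<and>
     (\<forall>t i. measure M {\<omega> \<in> space M. I t \<omega> = i}
              = (norm (row i A))\<^sup>2 / (frobenius_norm A)\<^sup>2)"

end

theory Submission imports Defs begin

text \<open>Let \<open>F = \<parallel>A\<parallel>\<^sub>F\<^sup>2\<close>, let \<open>c = 1 - 1 / \<kappa>\<^sup>2\<close>, and let \<open>r = b - A x\<^sub>\<star>\<close>, so that \<open>A\<^sup>T r = 0\<close>. The errors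
  \<open>e\<^sub>s = x\<^sub>s - x\<^sub>\<star>\<close> stay in the range of \<open>A\<^sup>T\<close>. Conditionally on the past, the mean of \<open>e\<^bsub>s+1\<^esub>\<close> is
  \<open>G e\<^sub>s\<close> with \<open>G = 1 - A\<^sup>T A / F\<close>, a positive semidefinite map that contracts the range of
  \<open>A\<^sup>T\<close> by the factor \<open>c\<close>, and the mean of \<open>\<parallel>e\<^bsub>s+1\<^esub>\<parallel>\<^sup>2\<close> is at most \<open>c \<parallel>e\<^sub>s\<parallel>\<^sup>2 + \<parallel>r\<parallel>\<^sup>2 / F\<close>. Hence
  \<open>E \<parallel>e\<^sub>s\<parallel>\<^sup>2 \<le> c\<^sup>s \<parallel>e\<^sub>0\<parallel>\<^sup>2 + C\<close> with \<open>C = \<parallel>A\<^sup>+\<parallel>\<^sup>2 \<parallel>r\<parallel>\<^sup>2\<close>, and the cross terms decay: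
  \<open>E (e\<^sub>s \<bullet> e\<^bsub>s+k\<^esub>) = E (G\<^sup>k e\<^sub>s \<bullet> e\<^sub>s) \<le> c\<^sup>k E \<parallel>e\<^sub>s\<parallel>\<^sup>2\<close>. Expanding the square of the average and
  summing the geometric series gives the bound.\<close>

section \<open>Functions of finitely many draws\<close>

text \<open>The first \<open>n\<close> draws take values in a finite discrete space, so every
  function of them is measurable and bounded by the sum of its absolute values over that
  space.\<close>

lemma (in prob_space) integrable_initial_segment:
  fixes X :: "nat \<Rightarrow> 'a \<Rightarrow> 'n::finite" and h :: "(nat \<Rightarrow> 'n) \<Rightarrow> real"
  assumes X: "\<And>k. X k \<in> measurable M (count_space UNIV)"
    and h: "\<And>u v. (\<And>k. k < n \<Longrightarrow> u k = v k) \<Longrightarrow> h u = h v"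
  shows "integrable M (\<lambda>\<omega>. h (\<lambda>k. X k \<omega>))"
proof -
  let ?S = "PiE {..<n} (\<lambda>_. UNIV :: 'n set)"
  have S: "PiM {..<n} (\<lambda>_. count_space (UNIV :: 'n set)) = count_space ?S"
    by (rule count_space_PiM_finite) auto
  have "(\<lambda>\<omega>. restrict (\<lambda>k. X k \<omega>) {..<n}) \<in> measurable M (PiM {..<n} (\<lambda>_. count_space UNIV))"
    by (intro measurable_restrict X)
  then have "(\<lambda>\<omega>. h (restrict (\<lambda>k. X k \<omega>) {..<n})) \<in> borel_measurable M"
    unfolding S by (rule measurable_compose) simp
  moreover have eq: "h (restrict (\<lambda>k. X k \<omega>) {..<n}) = h (\<lambda>k. X k \<omega>)" for \<omega>
    by (rule h) simp
  ultimately have meas: "(\<lambda>\<omega>. h (\<lambda>k. X k \<omega>)) \<in> borel_measurable M"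
    by simp
  have fin: "finite ?S" by (intro finite_PiE) auto
  have "\<bar>h (\<lambda>k. X k \<omega>)\<bar> \<le> (\<Sum>u\<in>?S. \<bar>h u\<bar>)" for \<omega>
    unfolding eq[symmetric]
    by (rule member_le_sum[where f = "\<lambda>u. \<bar>h u\<bar>"]) (use fin in auto)
  then show ?thesis
    using meas by (intro integrable_const_bound[where B = "\<Sum>u\<in>?S. \<bar>h u\<bar>"]) auto
qed

text \<open>Plays the role of conditioning on the first \<open>n\<close> draws: split over the value
  of \<open>X n\<close> with indicators, factor each summand by independence of draw
  \<open>n\<close> from the earlier ones, and reassemble.\<close>

lemma (in prob_space) expectation_next_draw:
  fixes X :: "nat \<Rightarrow> 'a \<Rightarrow> 'n::finite" and h :: "(nat \<Rightarrow> 'n) \<Rightarrow> 'n \<Rightarrow> real"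
  assumes indep: "indep_vars (\<lambda>_. count_space UNIV) X UNIV"
    and h: "\<And>u v i. (\<And>k. k < n \<Longrightarrow> u k = v k) \<Longrightarrow> h u i = h v i"
  shows "expectation (\<lambda>\<omega>. h (\<lambda>k. X k \<omega>) (X n \<omega>))
    = expectation (\<lambda>\<omega>. \<Sum>i\<in>UNIV. prob {\<omega>' \<in> space M. X n \<omega>' = i} * h (\<lambda>k. X k \<omega>) i)"
proof -
  have X: "X k \<in> measurable M (count_space UNIV)" for k
    using indep by (auto simp: indep_vars_def2)
  have int_h: "integrable M (\<lambda>\<omega>. h (\<lambda>k. X k \<omega>) i)" for i
    by (rule integrable_initial_segment[OF X, where n = n and h = "\<lambda>u. h u i"]) (rule h)
  let ?\<delta> = "\<lambda>i j. of_bool (j = i) :: real"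
  have int_\<delta>: "integrable M (\<lambda>\<omega>. ?\<delta> i (X n \<omega>))" for i
    by (rule integrable_initial_segment[OF X, where n = "Suc n" and h = "\<lambda>u. ?\<delta> i (u n)"]) simp
  have \<delta>: "expectation (\<lambda>\<omega>. ?\<delta> i (X n \<omega>)) = prob {\<omega> \<in> space M. X n \<omega> = i}" for i
  proof -
    have "expectation (\<lambda>\<omega>. ?\<delta> i (X n \<omega>)) = expectation (indicator {\<omega> \<in> space M. X n \<omega> = i})"
      by (intro Bochner_Integration.integral_cong) (auto simp: indicator_def)
    moreover have "{\<omega> \<in> space M. X n \<omega> = i} \<in> events"
      using measurable_sets[OF X, of "{i}" n] by (simp add: vimage_def Int_def conj_commute)
    ultimately show ?thesis by simp
  qed
  have ind: "indep_var borel (\<lambda>\<omega>. ?\<delta> i (X n \<omega>)) borel (\<lambda>\<omega>. h (\<lambda>k. X k \<omega>) i)" for i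
  proof -
    have S: "PiM J (\<lambda>_. count_space (UNIV :: 'n set)) = count_space (PiE J (\<lambda>_. UNIV))"
      if "finite J" for J :: "nat set"
      by (rule count_space_PiM_finite) (use that in auto)
    have "indep_var (PiM {n} (\<lambda>_. count_space UNIV)) (\<lambda>\<omega>. restrict (\<lambda>k. X k \<omega>) {n})
        (PiM {..<n} (\<lambda>_. count_space UNIV)) (\<lambda>\<omega>. restrict (\<lambda>k. X k \<omega>) {..<n})"
      by (rule indep_var_restrict[OF indep]) auto
    then have "indep_var borel ((\<lambda>u. ?\<delta> i (u n)) \<circ> (\<lambda>\<omega>. restrict (\<lambda>k. X k \<omega>) {n}))
        borel ((\<lambda>u. h u i) \<circ> (\<lambda>\<omega>. restrict (\<lambda>k. X k \<omega>) {..<n}))"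
      by (rule indep_var_compose) (simp_all add: S)
    moreover have "h (restrict (\<lambda>k. X k \<omega>) {..<n}) i = h (\<lambda>k. X k \<omega>) i" for \<omega>
      by (rule h) simp
    ultimately show ?thesis by (simp add: comp_def)
  qed
  have "expectation (\<lambda>\<omega>. h (\<lambda>k. X k \<omega>) (X n \<omega>))
      = expectation (\<lambda>\<omega>. \<Sum>i\<in>UNIV. ?\<delta> i (X n \<omega>) * h (\<lambda>k. X k \<omega>) i)"
    by simp
  also have "\<dots> = (\<Sum>i\<in>UNIV. expectation (\<lambda>\<omega>. ?\<delta> i (X n \<omega>) * h (\<lambda>k. X k \<omega>) i))"
    by (intro Bochner_Integration.integral_sum indep_var_integrable ind int_\<delta> int_h)
  also have "\<dots> = (\<Sum>i\<in>UNIV. prob {\<omega> \<in> space M. X n \<omega> = i} * expectation (\<lambda>\<omega>. h (\<lambda>k. X k \<omega>) i))"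
    by (simp add: indep_var_lebesgue_integral[OF ind int_\<delta> int_h] \<delta>)
  also have "\<dots> = expectation (\<lambda>\<omega>. \<Sum>i\<in>UNIV. prob {\<omega>' \<in> space M. X n \<omega>' = i} * h (\<lambda>k. X k \<omega>) i)"
    by (subst Bochner_Integration.integral_sum) (auto intro: int_h)
  finally show ?thesis .
qed

lemma rk_iterate_cong:
  assumes "\<And>k. k < s \<Longrightarrow> u k = v k"
  shows "rk_iterate A b x\<^sub>0 u s = rk_iterate A b x\<^sub>0 v s"
  using assms by (induction s) (auto simp: Let_def)

section \<open>Two elementary estimates: geometric sums and positive semidefinite maps\<close>

text \<open>With truncated subtraction the exponent is the distance between \<open>r\<close> and
  \<open>s\<close>. The indices below \<open>r\<close> contribute at most
  \<open>c / (1 - c)\<close>, the others at most \<open>1 / (1 - c)\<close>, and the total is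
  \<open>(1 + c) / (1 - c)\<close>.\<close>

lemma geometric_sum_bound:
  fixes c :: real
  assumes "0 \<le> c" "c < 1" "a \<le> r" "r < t"
  shows "(\<Sum>s = a..<t. c ^ ((r - s) + (s - r))) \<le> 2 / (1 - c) - 1"
proof -
  have le: "(1 - c) * (\<Sum>s = a..<r. c ^ (r - s)) \<le> c" if "a \<le> r" for r
    using that
  proof (induction r rule: dec_induct)
    case base
    then show ?case using assms by simp
  next
    case (step m)
    have "(\<Sum>s = a..<Suc m. c ^ (Suc m - s)) = c * (\<Sum>s = a..<m. c ^ (m - s)) + c"
      using step.hyps by (simp add: sum_distrib_left Suc_diff_le)
    then have "(1 - c) * (\<Sum>s = a..<Suc m. c ^ (Suc m - s))
        = c * ((1 - c) * (\<Sum>s = a..<m. c ^ (m - s))) + (1 - c) * c"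
      by (simp add: algebra_simps)
    also have "\<dots> \<le> c * c + (1 - c) * c"
      using step.IH assms by (intro add_right_mono mult_left_mono) auto
    finally show ?case by (simp add: algebra_simps)
  qed
  have ge: "(1 - c) * (\<Sum>s = r..<t. c ^ (s - r)) = 1 - c ^ (t - r)" if "r \<le> t" for t
    using that
  proof (induction t rule: dec_induct)
    case (step m)
    then show ?case by (simp add: distrib_left Suc_diff_le) (simp add: algebra_simps)
  qed simp
  have "(\<Sum>s = a..<t. c ^ ((r - s) + (s - r)))
      = (\<Sum>s = a..<r. c ^ ((r - s) + (s - r))) + (\<Sum>s = r..<t. c ^ ((r - s) + (s - r)))"
    by (rule sum.atLeastLessThan_concat[symmetric]) (use assms in auto)
  also have "\<dots> = (\<Sum>s = a..<r. c ^ (r - s)) + (\<Sum>s = r..<t. c ^ (s - r))"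
    by (intro arg_cong2[where f = "(+)"] sum.cong) auto
  finally have "(1 - c) * (\<Sum>s = a..<t. c ^ ((r - s) + (s - r)))
      = (1 - c) * (\<Sum>s = a..<r. c ^ (r - s)) + (1 - c) * (\<Sum>s = r..<t. c ^ (s - r))"
    by (simp add: distrib_left)
  also have "\<dots> \<le> c + 1"
    using le[of r] ge[of t] assms zero_le_power[of c "t - r"] by linarith
  finally have "(1 - c) * (\<Sum>s = a..<t. c ^ ((r - s) + (s - r))) \<le> c + 1" .
  then show ?thesis
    using assms by (simp add: field_simps)
qed

text \<open>Positivity of \<open>G\<close> at \<open>x - s G x\<close> for \<open>s = 1 / c\<close> yields the norm bound directly, without
  a spectral decomposition.\<close>

lemma psd_contraction:
  fixes G :: "'a::real_inner \<Rightarrow> 'a"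
  assumes lin: "linear G" and sym: "\<And>x y. G x \<bullet> y = x \<bullet> G y"
    and psd: "\<And>x. 0 \<le> G x \<bullet> x" and c: "0 \<le> c"
    and inv: "\<And>x. x \<in> S \<Longrightarrow> G x \<in> S"
    and bound: "\<And>x. x \<in> S \<Longrightarrow> G x \<bullet> x \<le> c * (norm x)\<^sup>2"
    and x: "x \<in> S"
  shows "norm (G x) \<le> c * norm x"
proof -
  define w where "w = G x"
  have key: "0 \<le> c * (norm x)\<^sup>2 - 2 * s * (norm w)\<^sup>2 + s\<^sup>2 * (c * (norm w)\<^sup>2)" for s
  proof -
    have "0 \<le> G (x - s *\<^sub>R w) \<bullet> (x - s *\<^sub>R w)" by (rule psd)
    also have "\<dots> = G x \<bullet> x - 2 * s * (norm w)\<^sup>2 + s\<^sup>2 * (G w \<bullet> w)"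
      using sym[of w x]
      by (simp add: linear_diff[OF lin] linear_scale[OF lin] w_def[symmetric] power2_norm_eq_inner
          algebra_simps inner_diff_left inner_diff_right power2_eq_square)
        (auto simp: power2_norm_eq_inner[symmetric] power2_eq_square)
    \<comment> \<open>Invariance of \<open>S\<close> under \<open>G\<close> puts \<open>w\<close> in
      \<open>S\<close>, so \<open>bound\<close> applies at \<open>w\<close> as well as at
      \<open>x\<close>.\<close>
    also have "\<dots> \<le> c * (norm x)\<^sup>2 - 2 * s * (norm w)\<^sup>2 + s\<^sup>2 * (c * (norm w)\<^sup>2)"
      using bound[OF x] bound[OF inv[OF x]]
      by (intro add_mono diff_right_mono mult_left_mono) (auto simp: w_def)
    finally show ?thesis .
  qed
  show ?thesis
  proof (cases "c = 0")
    case True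
    with key[of 1] show ?thesis by (simp add: w_def)
  next
    case False
    have "c * (norm x)\<^sup>2 - 2 * (1 / c) * (norm w)\<^sup>2 + (1 / c)\<^sup>2 * (c * (norm w)\<^sup>2)
        = ((c * norm x)\<^sup>2 - (norm w)\<^sup>2) / c"
      using False by (simp add: field_simps power2_eq_square)
    with key[of "1 / c"] have "(norm w)\<^sup>2 \<le> (c * norm x)\<^sup>2"
      using False c by (simp add: zero_le_divide_iff)
    then show ?thesis
      unfolding w_def using c by (meson mult_nonneg_nonneg norm_ge_zero power2_le_imp_le)
  qed
qed

section \<open>Rows, norms and the pseudoinverse\<close>

lemma mult_vec_nth_row: "(A *v v) $ i = row i A \<bullet> v" for A :: "real^'d^'n"
  by (simp add: matrix_vector_mul_component row_def)

lemma frobenius_sq_rows: "(frobenius_norm A)\<^sup>2 = (\<Sum>i\<in>UNIV. (norm (row i A))\<^sup>2)"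
  by (simp add: frobenius_norm_def sum_nonneg norm_vec_def L2_set_def row_def)

lemma norm_sq_mult_vec_rows:
  fixes A :: "real^'d^'n"
  shows "(norm (A *v v))\<^sup>2 = (\<Sum>i\<in>UNIV. (row i A \<bullet> v)\<^sup>2)"
  by (simp add: norm_vec_def L2_set_def sum_nonneg matrix_vector_mult_def row_def
      inner_vec_def)

lemma norm_mult_vec_le_frobenius:
  fixes A :: "real^'d^'n"
  shows "(norm (A *v v))\<^sup>2 \<le> (frobenius_norm A)\<^sup>2 * (norm v)\<^sup>2"
  unfolding norm_sq_mult_vec_rows frobenius_sq_rows sum_distrib_right
proof (rule sum_mono)
  fix i
  have "\<bar>row i A \<bullet> v\<bar>\<^sup>2 \<le> (norm (row i A) * norm v)\<^sup>2"
    by (intro power_mono Cauchy_Schwarz_ineq2) simp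
  then show "(row i A \<bullet> v)\<^sup>2 \<le> (norm (row i A))\<^sup>2 * (norm v)\<^sup>2"
    by (simp add: power_mult_distrib)
qed

lemma norm_mult_vec_le_spectral: "norm (A *v x) \<le> spectral_norm A * norm x"
  for A :: "real^'d^'n"
  unfolding spectral_norm_def by (rule onorm) (rule matrix_vector_mul_bounded_linear)

lemma row_in_range_transpose: "row i A \<in> range (\<lambda>y. transpose A *v y)" for A :: "real^'d^'n"
  by (rule image_eqI[where x = "axis i 1"])
    (simp_all add: matrix_vector_mult_basis column_transpose)

lemma subspace_range_transpose: "subspace (range (\<lambda>y. transpose A *v y))" for A :: "real^'d^'n"
  by (rule linear_subspace_image[OF matrix_vector_mul_linear subspace_UNIV])

text \<open>Writing \<open>P\<close> for the pseudoinverse, \<open>P = P A P\<close>, and symmetry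
  of \<open>P A\<close> turns its leading factor into
  \<open>transpose A ** transpose P\<close>.\<close>

lemma pseudoinverse_in_range_transpose:
  "pseudoinverse A *v b \<in> range (\<lambda>y. transpose A *v y)" for A :: "real^'d^'n"
proof -
  let ?P = "pseudoinverse A"
  have "?P *v b = ?P ** A *v (?P *v b)"
    using is_pseudoinverse_pseudoinverse[of A]
    by (simp add: is_pseudoinverse_def matrix_vector_mul_assoc)
  also have "\<dots> = transpose (?P ** A) *v (?P *v b)"
    using is_pseudoinverse_pseudoinverse[of A] by (simp add: is_pseudoinverse_def)
  also have "\<dots> = transpose A *v (transpose ?P *v (?P *v b))"
    by (simp only: matrix_transpose_mul matrix_vector_mul_assoc matrix_mul_assoc)
  finally show ?thesis by blast
qed

text \<open>These are the normal equations: symmetry of \<open>A P\<close> makes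
  \<open>transpose A ** (A ** P)\<close> the transpose of \<open>A P A = A\<close>.\<close>

lemma transpose_mult_residual:
  fixes A :: "real^'d^'n"
  shows "transpose A *v (b - A *v (pseudoinverse A *v b)) = 0"
proof -
  let ?P = "pseudoinverse A"
  have "transpose A ** (A ** ?P) = transpose A"
    using is_pseudoinverse_pseudoinverse[of A]
    unfolding is_pseudoinverse_def by (metis matrix_transpose_mul)
  then show ?thesis
    by (simp add: matrix_vector_mult_diff_distrib matrix_vector_mul_assoc)
qed

text \<open>On the range of the transpose \<open>P A\<close> acts as the identity, so
  \<open>v\<close> is recovered from \<open>A *v v\<close> by \<open>P\<close>.\<close>

lemma norm_le_spectral_pseudoinverse:
  fixes A :: "real^'d^'n"
  assumes "v \<in> range (\<lambda>y. transpose A *v y)"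
  shows "norm v \<le> spectral_norm (pseudoinverse A) * norm (A *v v)"
proof -
  let ?P = "pseudoinverse A"
  from assms obtain w where v: "v = transpose A *v w" by auto
  have "?P ** A ** transpose A = transpose A"
    using is_pseudoinverse_pseudoinverse[of A]
    unfolding is_pseudoinverse_def by (metis matrix_transpose_mul matrix_mul_assoc)
  then have "?P *v (A *v v) = v"
    by (simp only: v matrix_vector_mul_assoc matrix_mul_assoc)
  then show ?thesis
    using norm_mult_vec_le_spectral[of ?P "A *v v"] by simp
qed

lemma frobenius_pos: "A \<noteq> 0 \<Longrightarrow> 0 < frobenius_norm A"
  by (simp add: frobenius_norm_eq_norm)

text \<open>A nonzero row lies in the range of the transpose, where the upper bound by the Frobenius
  norm and the lower bound through the pseudoinverse can be chained. This makes the contraction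
  factor nonnegative.\<close>

lemma demmel_cond_ge_1:
  fixes A :: "real^'d^'n"
  assumes "A \<noteq> 0"
  shows "1 \<le> demmel_cond A"
proof -
  obtain i where i: "row i A \<noteq> 0"
    using assms by (metis row_def vec_nth_inverse vec_eq_iff zero_index)
  let ?v = "row i A"
  have "norm (A *v ?v) \<le> frobenius_norm A * norm ?v"
    using norm_mult_vec_le_frobenius[of A ?v] frobenius_pos[OF assms]
    by (metis less_imp_le mult_nonneg_nonneg norm_ge_zero power2_le_imp_le power_mult_distrib)
  moreover have "0 \<le> spectral_norm (pseudoinverse A)"
    unfolding spectral_norm_def by (rule onorm_pos_le) (rule matrix_vector_mul_bounded_linear)
  ultimately have "norm ?v \<le> spectral_norm (pseudoinverse A) * (frobenius_norm A * norm ?v)"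
    using norm_le_spectral_pseudoinverse[OF row_in_range_transpose[of i A]]
    by (meson mult_left_mono order_trans)
  then show ?thesis
    using i by (simp add: demmel_cond_def mult.assoc[symmetric])
qed

section \<open>The mean map \<open>G\<close> and its contraction on the range of the
  transpose\<close>

definition rk_mean_map :: "real^'d^'n \<Rightarrow> real^'d \<Rightarrow> real^'d" where
  "rk_mean_map A v = v - (1 / (frobenius_norm A)\<^sup>2) *\<^sub>R (transpose A *v (A *v v))"

lemma linear_rk_mean_map: "linear (rk_mean_map A)"
  unfolding rk_mean_map_def
  by (rule linearI) (simp_all add: matrix_vector_right_distrib scaleR_add_right algebra_simps
      matrix_vector_mult_scaleR)

lemma rk_mean_map_inner:
  "rk_mean_map A v \<bullet> w = v \<bullet> w - (A *v v) \<bullet> (A *v w) / (frobenius_norm A)\<^sup>2"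
  by (simp add: rk_mean_map_def inner_diff_left dot_lmul_matrix)

lemma rk_mean_map_sym: "rk_mean_map A v \<bullet> w = v \<bullet> rk_mean_map A w"
  using rk_mean_map_inner[of A v w] rk_mean_map_inner[of A w v] by (simp add: inner_commute)

text \<open>The quadratic form of \<open>G\<close> is \<open>\<parallel>x\<parallel>\<^sup>2 -
  \<parallel>A x\<parallel>\<^sup>2 / F\<close>. On the range, the pseudoinverse bound makes the
  subtracted term at least \<open>\<parallel>x\<parallel>\<^sup>2 / \<kappa>\<^sup>2\<close>;
  \<open>psd_contraction\<close> upgrades this to a norm bound.\<close>

lemma rk_mean_map_contraction:
  fixes A :: "real^'d^'n"
  assumes A: "A \<noteq> 0" and v: "v \<in> range (\<lambda>y. transpose A *v y)"
  shows "rk_mean_map A v \<bullet> v \<le> (1 - 1 / (demmel_cond A)\<^sup>2) * (norm v)\<^sup>2"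
    and "norm (rk_mean_map A v) \<le> (1 - 1 / (demmel_cond A)\<^sup>2) * norm v"
    and "rk_mean_map A v \<in> range (\<lambda>y. transpose A *v y)"
proof -
  let ?S = "range (\<lambda>y. transpose A *v y)" and ?F = "(frobenius_norm A)\<^sup>2"
  let ?\<sigma> = "spectral_norm (pseudoinverse A)"
  have F: "0 < ?F" using frobenius_pos[OF A] by simp
  have \<kappa>: "1 \<le> demmel_cond A" by (rule demmel_cond_ge_1[OF A])
  then have \<kappa>2: "1 \<le> (demmel_cond A)\<^sup>2" by simp
  have \<kappa>_eq: "(demmel_cond A)\<^sup>2 = ?\<sigma>\<^sup>2 * ?F" by (simp add: demmel_cond_def power_mult_distrib)
  have bound: "rk_mean_map A x \<bullet> x \<le> (1 - 1 / (demmel_cond A)\<^sup>2) * (norm x)\<^sup>2" if "x \<in> ?S" for x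
  proof -
    have "(norm x)\<^sup>2 \<le> (?\<sigma> * norm (A *v x))\<^sup>2"
      by (intro power_mono norm_le_spectral_pseudoinverse that) simp
    then have "(norm x)\<^sup>2 / (demmel_cond A)\<^sup>2 \<le> (?\<sigma> * norm (A *v x))\<^sup>2 / (demmel_cond A)\<^sup>2"
      by (rule divide_right_mono) simp
    \<comment> \<open>The factor \<open>?\<sigma>\<^sup>2\<close> cancels;
      \<open>?\<sigma> = 0\<close> would contradict
      \<open>1 \<le> (demmel_cond A)\<^sup>2\<close>.\<close>
    also have "\<dots> = (norm (A *v x))\<^sup>2 / ?F"
      using \<kappa>2 unfolding \<kappa>_eq power_mult_distrib by (cases "?\<sigma> = 0") auto
    finally show ?thesis
      by (simp add: rk_mean_map_inner power2_norm_eq_inner algebra_simps)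
  qed
  have inv: "rk_mean_map A x \<in> ?S" if "x \<in> ?S" for x
    unfolding rk_mean_map_def
    by (intro subspace_diff subspace_scale subspace_range_transpose that rangeI)
  show "rk_mean_map A v \<bullet> v \<le> (1 - 1 / (demmel_cond A)\<^sup>2) * (norm v)\<^sup>2"
    by (rule bound[OF v])
  show "rk_mean_map A v \<in> ?S"
    by (rule inv[OF v])
  show "norm (rk_mean_map A v) \<le> (1 - 1 / (demmel_cond A)\<^sup>2) * norm v"
  proof (rule psd_contraction[where S = ?S, OF linear_rk_mean_map _ _ _ inv bound v])
    show "rk_mean_map A x \<bullet> y = x \<bullet> rk_mean_map A y" for x y
      by (rule rk_mean_map_sym)
    show "0 \<le> rk_mean_map A x \<bullet> x" for x
      using norm_mult_vec_le_frobenius[of A x] F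
      by (simp add: rk_mean_map_inner power2_norm_eq_inner divide_le_eq mult.commute)
    show "0 \<le> 1 - 1 / (demmel_cond A)\<^sup>2" using \<kappa>2 by (simp add: divide_le_eq)
  qed
qed

text \<open>Range membership is carried through the induction because \<open>G\<close> fixes the
  kernel of \<open>A\<close> and so contracts only on the range.\<close>

lemma rk_mean_map_funpow:
  fixes A :: "real^'d^'n"
  assumes A: "A \<noteq> 0" and v: "v \<in> range (\<lambda>y. transpose A *v y)"
  shows "norm ((rk_mean_map A ^^ k) v) \<le> (1 - 1 / (demmel_cond A)\<^sup>2) ^ k * norm v
    \<and> (rk_mean_map A ^^ k) v \<in> range (\<lambda>y. transpose A *v y)"
proof (induction k)
  case (Suc k)
  have c: "0 \<le> 1 - 1 / (demmel_cond A)\<^sup>2"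
    using demmel_cond_ge_1[OF A] by simp
  let ?w = "(rk_mean_map A ^^ k) v"
  have "norm (rk_mean_map A ?w) \<le> (1 - 1 / (demmel_cond A)\<^sup>2) * norm ?w"
    using Suc by (intro rk_mean_map_contraction[OF A]) simp
  also have "\<dots> \<le> (1 - 1 / (demmel_cond A)\<^sup>2) * ((1 - 1 / (demmel_cond A)\<^sup>2) ^ k * norm v)"
    using Suc c by (intro mult_left_mono) auto
  finally show ?case
    using Suc rk_mean_map_contraction(3)[OF A] by (simp add: mult.assoc)
qed (use v in simp)

section \<open>One step of the error recursion: mean and mean square\<close>

text \<open>This is the Kaczmarz update for right-hand side \<open>r\<close>. Subtracting a fixed
  \<open>x\<close> from the iterates replaces \<open>b\<close> by the residual
  \<open>b - A *v x\<close>.\<close>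

definition rk_error_step :: "real^'d^'n \<Rightarrow> real^'n \<Rightarrow> 'n \<Rightarrow> real^'d \<Rightarrow> real^'d" where
  "rk_error_step A r i v = v + ((r $ i - row i A \<bullet> v) / (norm (row i A))\<^sup>2) *\<^sub>R row i A"

lemma rk_iterate_error_Suc:
  "rk_iterate A b x\<^sub>0 u (Suc s) - x
    = rk_error_step A (b - A *v x) (u s) (rk_iterate A b x\<^sub>0 u s - x)"
  by (simp add: rk_error_step_def Let_def inner_diff_right mult_vec_nth_row)

text \<open>The selection probability cancels the squared row norm in the step size, so the updates
  sum to \<open>transpose A *v (r - A *v v) / F\<close>, where \<open>r\<close> drops out. For a
  zero row both the weight and the direction vanish.\<close>

lemma rk_error_step_mean:
  fixes A :: "real^'d^'n"
  assumes A: "A \<noteq> 0" and r: "transpose A *v r = 0"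
  shows "(\<Sum>i\<in>UNIV. ((norm (row i A))\<^sup>2 / (frobenius_norm A)\<^sup>2) *\<^sub>R rk_error_step A r i v)
    = rk_mean_map A v"
proof -
  let ?F = "(frobenius_norm A)\<^sup>2"
  have F: "?F \<noteq> 0" using frobenius_pos[OF A] by simp
  have T: "transpose A *v w = (\<Sum>i\<in>UNIV. w $ i *\<^sub>R row i A)" for w
    by (simp add: matrix_mult_sum column_transpose scalar_mult_eq_scaleR)
  have "((norm (row i A))\<^sup>2 / ?F) *\<^sub>R rk_error_step A r i v
      = ((norm (row i A))\<^sup>2 / ?F) *\<^sub>R v + (1 / ?F) *\<^sub>R ((r $ i - (A *v v) $ i) *\<^sub>R row i A)" for i
    by (cases "row i A = 0")
      (auto simp: rk_error_step_def scaleR_add_right mult_vec_nth_row)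
  then have "(\<Sum>i\<in>UNIV. ((norm (row i A))\<^sup>2 / ?F) *\<^sub>R rk_error_step A r i v)
      = (\<Sum>i\<in>UNIV. (norm (row i A))\<^sup>2 / ?F) *\<^sub>R v + (1 / ?F) *\<^sub>R (transpose A *v (r - A *v v))"
    unfolding T by (simp add: sum.distrib scaleR_sum_left scaleR_sum_right)
  also have "(\<Sum>i\<in>UNIV. (norm (row i A))\<^sup>2 / ?F) = 1"
    using F by (simp add: sum_divide_distrib[symmetric] frobenius_sq_rows[symmetric])
  finally show ?thesis
    unfolding rk_mean_map_def matrix_vector_mult_diff_distrib r by simp
qed

text \<open>A step along a nonzero row \<open>a\<close> replaces the component
  \<open>a \<bullet> v\<close> by \<open>r $ i\<close>, changing the squared norm by the difference
  of their squares over \<open>\<parallel>a\<parallel>\<^sup>2\<close>. Averaging leaves the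
  quadratic form of \<open>G\<close> plus the noise term.\<close>

lemma rk_error_step_mean_square:
  fixes A :: "real^'d^'n"
  assumes A: "A \<noteq> 0" and v: "v \<in> range (\<lambda>y. transpose A *v y)"
  shows "(\<Sum>i\<in>UNIV. (norm (row i A))\<^sup>2 / (frobenius_norm A)\<^sup>2 * (norm (rk_error_step A r i v))\<^sup>2)
    \<le> (1 - 1 / (demmel_cond A)\<^sup>2) * (norm v)\<^sup>2 + (norm r)\<^sup>2 / (frobenius_norm A)\<^sup>2"
proof -
  let ?F = "(frobenius_norm A)\<^sup>2"
  have F: "0 < ?F" using frobenius_pos[OF A] by simp
  \<comment> \<open>Only an inequality, because a zero row gives \<open>0\<close> on the left and
    \<open>(r $ i)\<^sup>2 / ?F\<close> on the right.\<close>
  have "(norm (row i A))\<^sup>2 / ?F * (norm (rk_error_step A r i v))\<^sup>2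
      \<le> (norm (row i A))\<^sup>2 / ?F * (norm v)\<^sup>2 + ((r $ i)\<^sup>2 - (row i A \<bullet> v)\<^sup>2) / ?F" for i
  proof (cases "row i A = 0")
    case False
    let ?a = "row i A"
    have "(norm (v + k *\<^sub>R ?a))\<^sup>2 = (norm v)\<^sup>2 + 2 * k * (?a \<bullet> v) + k\<^sup>2 * (norm ?a)\<^sup>2" for k
      unfolding power2_norm_eq_inner
      by (simp add: inner_add_left inner_add_right inner_commute power2_eq_square)
    then have "(norm (rk_error_step A r i v))\<^sup>2
        = (norm v)\<^sup>2 + 2 * ((r $ i - ?a \<bullet> v) / (norm ?a)\<^sup>2) * (?a \<bullet> v)
          + ((r $ i - ?a \<bullet> v) / (norm ?a)\<^sup>2)\<^sup>2 * (norm ?a)\<^sup>2"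
      unfolding rk_error_step_def .
    also have "\<dots> = (norm v)\<^sup>2 + ((r $ i)\<^sup>2 - (?a \<bullet> v)\<^sup>2) / (norm ?a)\<^sup>2"
      using False by (simp add: power2_eq_square field_simps)
    finally show ?thesis
      using False by (simp add: distrib_left)
  qed (use F in auto)
  then have "(\<Sum>i\<in>UNIV. (norm (row i A))\<^sup>2 / ?F * (norm (rk_error_step A r i v))\<^sup>2)
      \<le> (\<Sum>i\<in>UNIV. (norm (row i A))\<^sup>2 / ?F * (norm v)\<^sup>2 + ((r $ i)\<^sup>2 - (row i A \<bullet> v)\<^sup>2) / ?F)"
    by (rule sum_mono)
  also have "\<dots> = (\<Sum>i\<in>UNIV. (norm (row i A))\<^sup>2) / ?F * (norm v)\<^sup>2
      + ((\<Sum>i\<in>UNIV. (r $ i)\<^sup>2) - (\<Sum>i\<in>UNIV. (row i A \<bullet> v)\<^sup>2)) / ?F"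
    by (simp add: sum.distrib sum_subtractf sum_divide_distrib sum_distrib_right diff_divide_distrib)
  also have "\<dots> = (norm v)\<^sup>2 - (norm (A *v v))\<^sup>2 / ?F + (norm r)\<^sup>2 / ?F"
    using F unfolding frobenius_sq_rows[symmetric] norm_sq_mult_vec_rows[symmetric]
    by (simp add: norm_vec_def[of r] L2_set_def sum_nonneg diff_divide_distrib)
  also have "\<dots> = rk_mean_map A v \<bullet> v + (norm r)\<^sup>2 / ?F"
    by (simp add: rk_mean_map_inner power2_norm_eq_inner)
  finally show ?thesis
    using rk_mean_map_contraction(1)[OF A v] by linarith
qed

section \<open>The error trajectory and its tail average\<close>

lemma rk_iterate_in_range_transpose:
  fixes A :: "real^'d^'n"
  assumes "x\<^sub>0 \<in> range (\<lambda>y. transpose A *v y)"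
  shows "rk_iterate A b x\<^sub>0 u s \<in> range (\<lambda>y. transpose A *v y)"
proof (induction s)
  case (Suc s)
  then show ?case
    unfolding rk_iterate.simps Let_def
    by (intro subspace_add subspace_scale subspace_range_transpose row_in_range_transpose)
qed (use assms in simp)

theorem theorem2:
  fixes A :: "real^'d^'n" and b :: "real^'n" and x\<^sub>0 xstar :: "real^'d" and \<kappa> :: real
    and t\<^sub>b t :: nat and M :: "'w measure" and I :: "nat \<Rightarrow> 'w \<Rightarrow> 'n"
  assumes "A \<noteq> 0"
    and "CARD('n) > CARD('d)"
    and "xstar = pseudoinverse A *v b"
    and "\<kappa> = demmel_cond A"
    and "x\<^sub>0 \<in> range (\<lambda>y. transpose A *v y)"
    and "t\<^sub>b < t"
    and "rk_sampling A M I"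
  shows "(\<integral>\<omega>. (norm (tark A b x\<^sub>0 (\<lambda>s. I s \<omega>) t\<^sub>b t - xstar))\<^sup>2 \<partial>M)
    \<le> (1 - 1 / \<kappa>\<^sup>2) ^ t\<^sub>b * (norm (x\<^sub>0 - xstar))\<^sup>2
      + (2 * \<kappa>\<^sup>2 - 1) / (real t - real t\<^sub>b)
        * (spectral_norm (pseudoinverse A))\<^sup>2 * (norm (b - A *v xstar))\<^sup>2"
proof -
  interpret prob_space M using assms(7) by (simp add: rk_sampling_def)
  have indep: "indep_vars (\<lambda>_. count_space UNIV) I UNIV"
    and p: "prob {\<omega> \<in> space M. I k \<omega> = i} = (norm (row i A))\<^sup>2 / (frobenius_norm A)\<^sup>2" for k i
    using assms(7) by (auto simp: rk_sampling_def)
  have I: "I k \<in> measurable M (count_space UNIV)" for k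
    using indep by (auto simp: indep_vars_def2)
  define r where "r = b - A *v xstar"
  define c where "c = 1 - 1 / \<kappa>\<^sup>2"
  \<comment> \<open>\<open>e\<close> is a function of the index sequence, as the lemmas on draws
    require; \<open>E\<close> is the corresponding random vector.\<close>
  define e where "e s u = rk_iterate A b x\<^sub>0 u s - xstar" for s u
  define E where "E s \<omega> = e s (\<lambda>k. I k \<omega>)" for s \<omega>
  define C where "C = (spectral_norm (pseudoinverse A))\<^sup>2 * (norm r)\<^sup>2"
  define G where "G = rk_mean_map A"
  have \<kappa>: "1 \<le> \<kappa>\<^sup>2"
    using demmel_cond_ge_1[OF assms(1)] assms(4) by simp
  then have c: "0 \<le> c" "c < 1"
    by (auto simp: c_def divide_le_eq zero_less_divide_iff)
  have F: "0 < (frobenius_norm A)\<^sup>2" using frobenius_pos[OF assms(1)] by simp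
  have r: "transpose A *v r = 0"
    unfolding r_def assms(3) by (rule transpose_mult_residual)
  have e_Suc: "e (Suc s) u = rk_error_step A r (u s) (e s u)" for s u
    unfolding e_def r_def by (rule rk_iterate_error_Suc)
  have e_cong: "e s u = e s v" if "\<And>k. k < s \<Longrightarrow> u k = v k" for s u v
    unfolding e_def using rk_iterate_cong[OF that] by simp
  have e_range: "e s u \<in> range (\<lambda>y. transpose A *v y)" for s u
    unfolding e_def assms(3)
    by (intro subspace_diff subspace_range_transpose rk_iterate_in_range_transpose assms(5)
        pseudoinverse_in_range_transpose)
  have int: "integrable M (\<lambda>\<omega>. f (E s \<omega>) (E s' \<omega>))" for f :: "_ \<Rightarrow> _ \<Rightarrow> real" and s s'
    unfolding E_def
  proof (rule integrable_initial_segment[OF I, where h = "\<lambda>u. f (e s u) (e s' u)"])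
    show "f (e s u) (e s' u) = f (e s v) (e s' v)"
      if "\<And>k. k < max s s' \<Longrightarrow> u k = v k" for u v
      using that e_cong[of s u v] e_cong[of s' u v] by simp
  qed
  have square: "expectation (\<lambda>\<omega>. (norm (E s \<omega>))\<^sup>2) \<le> c ^ s * (norm (x\<^sub>0 - xstar))\<^sup>2 + C" for s
  proof (induction s)
    case 0
    then show ?case by (simp add: E_def e_def C_def prob_space)
  next
    case (Suc s)
    \<comment> \<open>The error \<open>e s\<close> depends only on draws below \<open>s\<close>, so
      draw \<open>s\<close>, which produces \<open>e (Suc s)\<close>, is fresh.\<close>
    have "expectation (\<lambda>\<omega>. (norm (E (Suc s) \<omega>))\<^sup>2)
        = expectation (\<lambda>\<omega>. \<Sum>i\<in>UNIV. (norm (row i A))\<^sup>2 / (frobenius_norm A)\<^sup>2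
            * (norm (rk_error_step A r i (E s \<omega>)))\<^sup>2)"
      unfolding E_def e_Suc p[of s, symmetric]
    proof (rule expectation_next_draw[OF indep, where h = "\<lambda>u i. (norm (rk_error_step A r i (e s u)))\<^sup>2"])
      show "(norm (rk_error_step A r i (e s u)))\<^sup>2 = (norm (rk_error_step A r i (e s v)))\<^sup>2"
        if "\<And>k. k < s \<Longrightarrow> u k = v k" for u v i
        using e_cong[OF that] by simp
    qed
    also have "\<dots> \<le> expectation (\<lambda>\<omega>. c * (norm (E s \<omega>))\<^sup>2 + (norm r)\<^sup>2 / (frobenius_norm A)\<^sup>2)"
    proof (intro integral_mono)
      show "integrable M (\<lambda>\<omega>. \<Sum>i\<in>UNIV. (norm (row i A))\<^sup>2 / (frobenius_norm A)\<^sup>2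
            * (norm (rk_error_step A r i (E s \<omega>)))\<^sup>2)"
        by (rule int[of "\<lambda>x _. \<Sum>i\<in>UNIV. (norm (row i A))\<^sup>2 / (frobenius_norm A)\<^sup>2
            * (norm (rk_error_step A r i x))\<^sup>2" s])
      show "integrable M (\<lambda>\<omega>. c * (norm (E s \<omega>))\<^sup>2 + (norm r)\<^sup>2 / (frobenius_norm A)\<^sup>2)"
        by (rule int[of "\<lambda>x _. c * (norm x)\<^sup>2 + (norm r)\<^sup>2 / (frobenius_norm A)\<^sup>2" s])
      show "(\<Sum>i\<in>UNIV. (norm (row i A))\<^sup>2 / (frobenius_norm A)\<^sup>2
            * (norm (rk_error_step A r i (E s \<omega>)))\<^sup>2)
          \<le> c * (norm (E s \<omega>))\<^sup>2 + (norm r)\<^sup>2 / (frobenius_norm A)\<^sup>2" for \<omega>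
        unfolding c_def assms(4) E_def
        by (rule rk_error_step_mean_square[OF assms(1) e_range])
    qed
    also have "\<dots> = c * expectation (\<lambda>\<omega>. (norm (E s \<omega>))\<^sup>2) + (norm r)\<^sup>2 / (frobenius_norm A)\<^sup>2"
      using int[of "\<lambda>x _. (norm x)\<^sup>2" s] by (simp add: prob_space)
    also have "\<dots> \<le> c * (c ^ s * (norm (x\<^sub>0 - xstar))\<^sup>2 + C) + (norm r)\<^sup>2 / (frobenius_norm A)\<^sup>2"
      using Suc c by (intro add_right_mono mult_left_mono) auto
    also have "\<dots> = c ^ Suc s * (norm (x\<^sub>0 - xstar))\<^sup>2 + C"
    proof -
      \<comment> \<open>\<open>C\<close> is chosen as the fixed point of
        \<open>y \<mapsto> c * y + \<parallel>r\<parallel>\<^sup>2 / F\<close>, so the noise does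
        not accumulate over the steps.\<close>
      have "C / \<kappa>\<^sup>2 = (norm r)\<^sup>2 / (frobenius_norm A)\<^sup>2"
        using \<kappa> F unfolding C_def assms(4) demmel_cond_def power_mult_distrib by auto
      then have "c * C + (norm r)\<^sup>2 / (frobenius_norm A)\<^sup>2 = C"
        by (simp add: c_def algebra_simps)
      then show ?thesis by (simp add: algebra_simps)
    qed
    finally show ?case .
  qed
  \<comment> \<open>The map \<open>L\<close> is arbitrary so that the induction can peel off the
    last draw and move the resulting \<open>G\<close> to the other factor by symmetry, replacing
    \<open>L\<close> by \<open>G\<close> after \<open>L\<close>.\<close>
  have cross: "expectation (\<lambda>\<omega>. L (E s \<omega>) \<bullet> E (s + k) \<omega>)
      = expectation (\<lambda>\<omega>. (G ^^ k) (L (E s \<omega>)) \<bullet> E s \<omega>)" for L s k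
  proof (induction k arbitrary: L)
    case (Suc k)
    have "expectation (\<lambda>\<omega>. L (E s \<omega>) \<bullet> E (s + Suc k) \<omega>)
        = expectation (\<lambda>\<omega>. \<Sum>i\<in>UNIV. (norm (row i A))\<^sup>2 / (frobenius_norm A)\<^sup>2
            * (L (E s \<omega>) \<bullet> rk_error_step A r i (E (s + k) \<omega>)))"
      unfolding E_def add_Suc_right e_Suc p[of "s + k", symmetric]
    proof (rule expectation_next_draw[OF indep,
          where h = "\<lambda>u i. L (e s u) \<bullet> rk_error_step A r i (e (s + k) u)"])
      show "L (e s u) \<bullet> rk_error_step A r i (e (s + k) u)
          = L (e s v) \<bullet> rk_error_step A r i (e (s + k) v)"
        if "\<And>j. j < s + k \<Longrightarrow> u j = v j" for u v i
        using e_cong[OF that] e_cong[of s u v] that by simp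
    qed
    also have "\<dots> = expectation (\<lambda>\<omega>. L (E s \<omega>) \<bullet> G (E (s + k) \<omega>))"
      unfolding G_def rk_error_step_mean[OF assms(1) r, symmetric] by (simp add: inner_sum_right)
    also have "\<dots> = expectation (\<lambda>\<omega>. G (L (E s \<omega>)) \<bullet> E (s + k) \<omega>)"
      unfolding G_def rk_mean_map_sym ..
    also have "\<dots> = expectation (\<lambda>\<omega>. (G ^^ Suc k) (L (E s \<omega>)) \<bullet> E s \<omega>)"
      using Suc.IH[of "\<lambda>x. G (L x)"] by (simp add: funpow_swap1)
    finally show ?case .
  qed simp
  have cross_le: "expectation (\<lambda>\<omega>. E s \<omega> \<bullet> E (s + k) \<omega>)
      \<le> c ^ (s + k) * (norm (x\<^sub>0 - xstar))\<^sup>2 + c ^ k * C" for s k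
  proof -
    have "expectation (\<lambda>\<omega>. E s \<omega> \<bullet> E (s + k) \<omega>) = expectation (\<lambda>\<omega>. (G ^^ k) (E s \<omega>) \<bullet> E s \<omega>)"
      using cross[of "\<lambda>x. x"] .
    also have "\<dots> \<le> expectation (\<lambda>\<omega>. c ^ k * (norm (E s \<omega>))\<^sup>2)"
    proof (intro integral_mono)
      show "integrable M (\<lambda>\<omega>. (G ^^ k) (E s \<omega>) \<bullet> E s \<omega>)"
        by (rule int[of "\<lambda>x y. (G ^^ k) x \<bullet> y" s s])
      show "integrable M (\<lambda>\<omega>. c ^ k * (norm (E s \<omega>))\<^sup>2)"
        by (rule int[of "\<lambda>x _. c ^ k * (norm x)\<^sup>2" s])
      fix \<omega>
      have "(G ^^ k) (E s \<omega>) \<bullet> E s \<omega> \<le> norm ((G ^^ k) (E s \<omega>)) * norm (E s \<omega>)"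
        by (rule norm_cauchy_schwarz)
      also have "\<dots> \<le> c ^ k * norm (E s \<omega>) * norm (E s \<omega>)"
        unfolding G_def c_def assms(4) E_def
        by (intro mult_right_mono conjunct1[OF rk_mean_map_funpow[OF assms(1) e_range]]) simp
      finally show "(G ^^ k) (E s \<omega>) \<bullet> E s \<omega> \<le> c ^ k * (norm (E s \<omega>))\<^sup>2"
        by (simp add: power2_eq_square mult.assoc)
    qed
    also have "\<dots> = c ^ k * expectation (\<lambda>\<omega>. (norm (E s \<omega>))\<^sup>2)"
      by simp
    also have "\<dots> \<le> c ^ k * (c ^ s * (norm (x\<^sub>0 - xstar))\<^sup>2 + C)"
      using square c by (intro mult_left_mono) auto
    finally show ?thesis by (simp add: power_add algebra_simps)
  qed
  \<comment> \<open>With the smaller index as \<open>s\<close> and the gap as \<open>k\<close>, the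
    initial error decays with the larger index, hence at least like \<open>c ^ t\<^sub>b\<close>,
    while the noise decays with the gap.\<close>
  have pair: "expectation (\<lambda>\<omega>. E s \<omega> \<bullet> E s' \<omega>)
      \<le> c ^ t\<^sub>b * (norm (x\<^sub>0 - xstar))\<^sup>2 + c ^ ((s - s') + (s' - s)) * C"
    if "t\<^sub>b \<le> s" "t\<^sub>b \<le> s'" for s s'
  proof -
    have "expectation (\<lambda>\<omega>. E s \<omega> \<bullet> E s' \<omega>)
        \<le> c ^ max s s' * (norm (x\<^sub>0 - xstar))\<^sup>2 + c ^ ((s - s') + (s' - s)) * C"
    proof (cases "s \<le> s'")
      case True
      then show ?thesis using cross_le[of s "s' - s"] by (simp add: max_def)
    next
      case False
      then show ?thesis using cross_le[of s' "s - s'"] by (simp add: max_def inner_commute)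
    qed
    moreover have "c ^ max s s' \<le> c ^ t\<^sub>b"
      using c that by (intro power_decreasing) auto
    ultimately show ?thesis
      by (smt (verit) mult_right_mono zero_le_power2)
  qed
  define N where "N = real t - real t\<^sub>b"
  have N: "0 < N" "real (card {t\<^sub>b..<t}) = N"
    using assms(6) by (auto simp: N_def)
  have "tark A b x\<^sub>0 (\<lambda>s. I s \<omega>) t\<^sub>b t - xstar = (1 / N) *\<^sub>R (\<Sum>s = t\<^sub>b..<t. E s \<omega>)" for \<omega>
  proof -
    have "(\<Sum>s = t\<^sub>b..<t. E s \<omega>)
        = (\<Sum>s = t\<^sub>b..<t. rk_iterate A b x\<^sub>0 (\<lambda>s. I s \<omega>) s) - N *\<^sub>R xstar"
      by (simp add: E_def e_def sum_subtractf sum_constant_scaleR N(2)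
          del: card_atLeastLessThan sum_constant)
    then show ?thesis
      using N(1) by (simp add: tark_def N_def[symmetric] scaleR_diff_right)
  qed
  then have "(norm (tark A b x\<^sub>0 (\<lambda>s. I s \<omega>) t\<^sub>b t - xstar))\<^sup>2
      = (\<Sum>s = t\<^sub>b..<t. \<Sum>s' = t\<^sub>b..<t. E s \<omega> \<bullet> E s' \<omega>) / N\<^sup>2" for \<omega>
    by (simp add: power2_norm_eq_inner inner_sum_left inner_sum_right power_divide
        power2_eq_square[of N] inner_commute)
  then have "(\<integral>\<omega>. (norm (tark A b x\<^sub>0 (\<lambda>s. I s \<omega>) t\<^sub>b t - xstar))\<^sup>2 \<partial>M)
      = (\<Sum>s = t\<^sub>b..<t. \<Sum>s' = t\<^sub>b..<t. expectation (\<lambda>\<omega>. E s \<omega> \<bullet> E s' \<omega>)) / N\<^sup>2"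
    using int[of "\<lambda>x y. x \<bullet> y"] by (simp add: Bochner_Integration.integral_sum)
  also have "\<dots> \<le> (\<Sum>s = t\<^sub>b..<t. \<Sum>s' = t\<^sub>b..<t.
      c ^ t\<^sub>b * (norm (x\<^sub>0 - xstar))\<^sup>2 + c ^ ((s - s') + (s' - s)) * C) / N\<^sup>2"
    by (intro divide_right_mono sum_mono pair) auto
  also have "\<dots> = (\<Sum>s = t\<^sub>b..<t. N * (c ^ t\<^sub>b * (norm (x\<^sub>0 - xstar))\<^sup>2)
      + (\<Sum>s' = t\<^sub>b..<t. c ^ ((s - s') + (s' - s))) * C) / N\<^sup>2"
    by (simp only: sum.distrib sum_constant sum_distrib_right N(2))
  \<comment> \<open>Each row of the double sum keeps \<open>N\<close> copies of the initial-error
    term but only a bounded amount of noise; this is why averaging divides the noise by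
    \<open>N\<close>.\<close>
  also have "\<dots> \<le> (\<Sum>s = t\<^sub>b..<t. N * (c ^ t\<^sub>b * (norm (x\<^sub>0 - xstar))\<^sup>2)
      + (2 / (1 - c) - 1) * C) / N\<^sup>2"
    using c by (intro divide_right_mono sum_mono add_left_mono mult_right_mono geometric_sum_bound)
      (auto simp: C_def)
  \<comment> \<open>Since \<open>1 - c = 1 / \<kappa>\<^sup>2\<close>, the geometric bound
    \<open>2 / (1 - c) - 1\<close> is \<open>2 * \<kappa>\<^sup>2 - 1\<close>.\<close>
  also have "\<dots> = (N * (N * (c ^ t\<^sub>b * (norm (x\<^sub>0 - xstar))\<^sup>2) + (2 * \<kappa>\<^sup>2 - 1) * C)) / N\<^sup>2"
    by (simp only: sum_constant N(2)) (simp add: c_def)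
  also have "\<dots> = c ^ t\<^sub>b * (norm (x\<^sub>0 - xstar))\<^sup>2 + (2 * \<kappa>\<^sup>2 - 1) / N * C"
    using N(1) by (simp add: field_simps power2_eq_square)
  finally show ?thesis
    by (simp add: c_def N_def C_def r_def mult.assoc)
qed

end
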